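(* For every integer $k>0$, the language $\mathtt{MODXOR}_k$ is recognized with zero error by an affine finite automaton with $2k+1$ states.
   Context: For $k>0$, $\mathtt{MODXOR}_k\subseteq\{0,1\}^*$ is the set of strings of the form $w_0\,x_1\,u_1\,x_2\,u_2\cdots x_m\,u_m$ where $m>0$, $w_0\in\{0,1\}^*$ has length less than $2k$, each $x_i\in\{0,1\}$, each $u_i\in\{0,1\}^{2k-1}$, and $x_1\oplus\cdots\oplus x_m=1$. An affine finite automaton (AfA) with states $E=\{e_1,\dots,e_m\}$ has an initial affine state $v_0\in\mathbb{R}^m$ (a real vector whose entries sum to $1$), a set of accepting states $E_a\subseteq E$, and for each input symbol (and optionally for a right end-marker read after the input) an affine operator, i.e. a real $m\times m$ matrix each of whose columns sums to $1$. On input $w$ the operators are applied in order to $v_0$ giving a final vector $v_f$, and the input is accepted with probability $\sum_{e_i\in E_a}|v_f[i]|/\|v_f\|_1$. It recognizes $L$ with zero error if members are accepted with probability $1$ and non-members with probability $0$. *)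

theory Defs
  imports "Jordan_Normal_Form.Matrix"
begin

text \<open>Bits are booleans, with \<^const>\<open>True\<close> for 1; the list \<open>bs\<close> below consists of the
  pairs \<open>(x\<^sub>i, u\<^sub>i)\<close>.\<close>

definition xor_list :: "bool list \<Rightarrow> bool" where
  "xor_list xs = foldr (\<noteq>) xs False"

definition MODXOR :: "nat \<Rightarrow> bool list set" where
  "MODXOR k = {w\<^sub>0 @ concat (map (\<lambda>(x, u). x # u) bs) | w\<^sub>0 bs.
     length w\<^sub>0 < 2 * k \<and> length bs > 0 \<and>
     (\<forall>(x, u) \<in> set bs. length u = 2 * k - 1) \<and>
     xor_list (map fst bs)}"

definition affine_state :: "nat \<Rightarrow> real vec \<Rightarrow> bool" where
  "affine_state m v \<longleftrightarrow> v \<in> carrier_vec m \<and> (\<Sum>i<m. v $ i) = 1"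

definition affine_operator :: "nat \<Rightarrow> real mat \<Rightarrow> bool" where
  "affine_operator m A \<longleftrightarrow> A \<in> carrier_mat m m \<and> (\<forall>j<m. (\<Sum>i<m. A $$ (i, j)) = 1)"

text \<open>The states are the indices below \<open>num_states\<close>. The field \<open>end_op\<close> is the operator of
  the right end-marker, \<^const>\<open>None\<close> for an automaton without end-marker.\<close>

record 'a afa =
  num_states :: nat
  init_state :: "real vec"
  accepting :: "nat set"
  symbol_op :: "'a \<Rightarrow> real mat"
  end_op :: "real mat option"

definition is_afa :: "'a afa \<Rightarrow> bool" where
  "is_afa M \<longleftrightarrow>
     affine_state (num_states M) (init_state M) \<and>
     accepting M \<subseteq> {..<num_states M} \<and>
     (\<forall>a. affine_operator (num_states M) (symbol_op M a)) \<and>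
     (\<forall>A. end_op M = Some A \<longrightarrow> affine_operator (num_states M) A)"

definition final_state :: "'a afa \<Rightarrow> 'a list \<Rightarrow> real vec" where
  "final_state M w =
     (let v = foldl (\<lambda>v a. symbol_op M a *\<^sub>v v) (init_state M) w
      in case end_op M of None \<Rightarrow> v | Some A \<Rightarrow> A *\<^sub>v v)"

definition accept_prob :: "'a afa \<Rightarrow> 'a list \<Rightarrow> real" where
  "accept_prob M w =
     (\<Sum>i\<in>accepting M. \<bar>final_state M w $ i\<bar>) / (\<Sum>i<num_states M. \<bar>final_state M w $ i\<bar>)"

definition recognizes_zero_error :: "'a afa \<Rightarrow> 'a list set \<Rightarrow> bool" where
  "recognizes_zero_error M L \<longleftrightarrow>
     (\<forall>w\<in>L. accept_prob M w = 1) \<and> (\<forall>w. w \<notin> L \<longrightarrow> accept_prob M w = 0)"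

end

theory Submission imports Defs begin

text \<open>Put \<open>n = 2k\<close> and count positions from the right end of the input, starting at 0. Membership in
  \<open>MODXOR\<^sub>k\<close> says that the xor of the bits at positions congruent to \<open>n - 1\<close> modulo \<open>n\<close> is 1.
  Encode the xor of each residue class as a sign: appending a symbol shifts the \<open>n\<close> signs cyclically
  and multiplies the wrapped-around one by the sign of the new symbol, which is a linear map. One
  further coordinate absorbs what is needed to make every column sum 1. The end-marker operator then
  maps a sign \<open>s\<close> to \<open>(1 - s) / 2\<close>, using that the coordinates of an affine state sum to 1.\<close>

text \<open>For \<open>j < n\<close> this is the xor of the entries at indices congruent to
  \<open>j\<close> modulo \<open>n\<close>. It is applied to the reversed input, so that the
  recursion follows the automaton as it reads one more symbol.\<close>

fun residue_xor :: "nat \<Rightarrow> bool list \<Rightarrow> nat \<Rightarrow> bool" where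
  "residue_xor n [] j = False"
| "residue_xor n (b # r) j =
     (if j = 0 then b \<noteq> residue_xor n r (n - 1) else residue_xor n r (j - 1))"

lemma residue_xor_short:
  "length r \<le> j \<Longrightarrow> \<not> residue_xor n r j"
  by (induction r arbitrary: j) auto

lemma residue_xor_append:
  "length u \<le> j \<Longrightarrow> residue_xor n (u @ r) j = residue_xor n r (j - length u)"
  by (induction u arbitrary: j) auto

lemma xor_list_snoc: "xor_list (xs @ [x]) = (x \<noteq> xor_list xs)"
  unfolding xor_list_def by (induction xs) auto

text \<open>Read from the right, a block takes the index from \<open>n - 1\<close> down to 0 along
  \<open>u\<close>; there \<open>x\<close> enters the xor and the index wraps back to
  \<open>n - 1\<close>. The remaining \<open>w\<close> is too short to reach index 0.\<close>

lemma residue_xor_blocks: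
  assumes "length w < n" and "\<forall>(x, u) \<in> set bs. length u = n - 1"
  shows "residue_xor n (rev (w @ concat (map (\<lambda>(x, u). x # u) bs))) (n - 1)
    = xor_list (map fst bs)"
  using assms(2)
proof (induction bs rule: rev_induct)
  case Nil
  show ?case
    using residue_xor_short[of "rev w" "n - 1" n] assms(1) by (simp add: xor_list_def)
next
  case (snoc b bs)
  obtain x u where b: "b = (x, u)" by fastforce
  then have "length u = n - 1" using snoc.prems by simp
  then show ?case
    using snoc by (simp add: b residue_xor_append xor_list_snoc)
qed

text \<open>Blocks of length \<open>n\<close> are cut off at the right end until fewer than
  \<open>n\<close> symbols remain.\<close>

lemma block_decomposition:
  fixes w :: "'a list"
  assumes "n > 0"
  shows "\<exists>w\<^sub>0 bs. w = w\<^sub>0 @ concat (map (\<lambda>(x, u). x # u) bs) \<and> length w\<^sub>0 < n \<and>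
    (\<forall>(x, u) \<in> set bs. length u = n - 1)"
proof (induction w rule: length_induct)
  case (1 w)
  show ?case
  proof (cases "length w < n")
    case True
    then show ?thesis by (intro exI[of _ w] exI[of _ "[]"]) simp
  next
    case False
    define p where "p = take (length w - n) w"
    define q where "q = drop (length w - n) w"
    have w: "w = p @ q" by (simp add: p_def q_def)
    have "length q = Suc (n - 1)" using False assms by (simp add: q_def)
    then obtain x u where q: "q = x # u" "length u = n - 1"
      by (metis length_Suc_conv)
    have "length p < length w" using w q by simp
    then obtain w\<^sub>0 bs where "p = w\<^sub>0 @ concat (map (\<lambda>(x, u). x # u) bs)" "length w\<^sub>0 < n"
      "\<forall>(x, u) \<in> set bs. length u = n - 1"
      using 1 by blast
    then show ?thesis
      using w q by (intro exI[of _ w\<^sub>0] exI[of _ "bs @ [(x, u)]"]) auto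
  qed
qed

lemma MODXOR_iff_residue_xor:
  assumes "k > 0"
  shows "w \<in> MODXOR k \<longleftrightarrow> residue_xor (2 * k) (rev w) (2 * k - 1)"
proof
  assume "w \<in> MODXOR k"
  then obtain w\<^sub>0 bs where "w = w\<^sub>0 @ concat (map (\<lambda>(x, u). x # u) bs)" "length w\<^sub>0 < 2 * k"
    "\<forall>(x, u) \<in> set bs. length u = 2 * k - 1" "xor_list (map fst bs)"
    unfolding MODXOR_def by blast
  then show "residue_xor (2 * k) (rev w) (2 * k - 1)"
    using residue_xor_blocks by blast
next
  assume R: "residue_xor (2 * k) (rev w) (2 * k - 1)"
  obtain w\<^sub>0 bs where dec: "w = w\<^sub>0 @ concat (map (\<lambda>(x, u). x # u) bs)" "length w\<^sub>0 < 2 * k"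
    "\<forall>(x, u) \<in> set bs. length u = 2 * k - 1"
    using block_decomposition[of "2 * k" w] assms by auto
  then have xor: "xor_list (map fst bs)"
    using R residue_xor_blocks by blast
  then have "length bs > 0" by (auto simp: xor_list_def)
  then show "w \<in> MODXOR k"
    unfolding MODXOR_def using dec xor by blast
qed

text \<open>The column sums force the last row, which leaves the first \<open>n\<close> rows free,
  including their entries in column \<open>n\<close>.\<close>

definition affine_completion :: "nat \<Rightarrow> (nat \<Rightarrow> nat \<Rightarrow> real) \<Rightarrow> real mat" where
  "affine_completion n B =
     mat (Suc n) (Suc n) (\<lambda>(i, j). if i < n then B i j else 1 - (\<Sum>l<n. B l j))"

lemma affine_operator_completion: "affine_operator (Suc n) (affine_completion n B)"
  by (simp add: affine_operator_def affine_completion_def)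

lemma affine_completion_mult_vec:
  assumes "v \<in> carrier_vec (Suc n)" and "i < n"
  shows "(affine_completion n B *\<^sub>v v) $ i = (\<Sum>j<Suc n. B i j * v $ j)"
  using assms
  by (auto simp: affine_completion_def mult_mat_vec_def scalar_prod_def atLeast0LessThan
      simp del: sum.lessThan_Suc intro!: sum.cong)

lemma affine_state_mult:
  assumes "affine_operator m A" and "affine_state m v"
  shows "affine_state m (A *\<^sub>v v)"
proof -
  have A: "A \<in> carrier_mat m m" "\<And>j. j < m \<Longrightarrow> (\<Sum>i<m. A $$ (i, j)) = 1"
    and v: "v \<in> carrier_vec m" "(\<Sum>j<m. v $ j) = 1"
    using assms by (auto simp: affine_operator_def affine_state_def)
  have "(\<Sum>i<m. (A *\<^sub>v v) $ i) = (\<Sum>i<m. \<Sum>j<m. A $$ (i, j) * v $ j)"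
    using A(1) v(1) by (auto simp: mult_mat_vec_def scalar_prod_def atLeast0LessThan intro!: sum.cong)
  also have "\<dots> = (\<Sum>j<m. (\<Sum>i<m. A $$ (i, j)) * v $ j)"
    by (subst sum.swap) (simp add: sum_distrib_right)
  also have "\<dots> = 1" using A(2) v(2) by simp
  finally show ?thesis using A(1) v(1) by (simp add: affine_state_def)
qed

definition bit_sign :: "bool \<Rightarrow> real" where
  "bit_sign b = (if b then -1 else 1)"

text \<open>Coordinate \<open>n\<close> enters none of the rows below \<open>n\<close>, so the slack
  stored there never disturbs the signs.\<close>

definition shift_op :: "nat \<Rightarrow> bool \<Rightarrow> real mat" where
  "shift_op n b = affine_completion n
     (\<lambda>i j. if i = 0 then (if j = n - 1 then bit_sign b else 0) else if j = i - 1 then 1 else 0)"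

text \<open>Row 0 halves the sum of all coordinates but \<open>n - 1\<close>, coordinate
  \<open>n\<close> included; as the total is 1, this is \<open>(1 - v $ (n - 1)) / 2\<close>. The
  rows strictly between 0 and \<open>n\<close> vanish, so the remaining weight sits in coordinate
  \<open>n\<close>.\<close>

definition readout_op :: "nat \<Rightarrow> real mat" where
  "readout_op n = affine_completion n (\<lambda>i j. if i = 0 \<and> j \<noteq> n - 1 then 1 / 2 else 0)"

text \<open>The empty word has all signs 1; the last entry brings the total to 1.\<close>

definition modxor_afa :: "nat \<Rightarrow> bool afa" where
  "modxor_afa n = \<lparr>num_states = Suc n,
     init_state = vec (Suc n) (\<lambda>i. if i < n then 1 else 1 - real n),
     accepting = {0}, symbol_op = shift_op n, end_op = Some (readout_op n)\<rparr>"

lemma is_afa_modxor: "is_afa (modxor_afa n)"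
  by (simp add: is_afa_def modxor_afa_def affine_state_def shift_op_def readout_op_def
      affine_operator_completion)

text \<open>Affinity is part of the invariant because the readout relies on the total being
  1.\<close>

lemma modxor_afa_run:
  fixes n :: nat and w :: "bool list"
  assumes "n > 0"
  defines "v \<equiv> foldl (\<lambda>v a. symbol_op (modxor_afa n) a *\<^sub>v v) (init_state (modxor_afa n)) w"
  shows "affine_state (Suc n) v \<and> (\<forall>i<n. v $ i = bit_sign (residue_xor n (rev w) i))"
  unfolding v_def
proof (induction w rule: rev_induct)
  case Nil
  show ?case by (simp add: modxor_afa_def affine_state_def bit_sign_def)
next
  case (snoc b w)
  let ?u = "foldl (\<lambda>v a. symbol_op (modxor_afa n) a *\<^sub>v v) (init_state (modxor_afa n)) w"
  have u: "affine_state (Suc n) ?u" "\<And>i. i < n \<Longrightarrow> ?u $ i = bit_sign (residue_xor n (rev w) i)"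
    using snoc.IH by auto
  have carrier: "?u \<in> carrier_vec (Suc n)" using u(1) by (simp add: affine_state_def)
  have "affine_state (Suc n) (shift_op n b *\<^sub>v ?u)"
    unfolding shift_op_def using affine_operator_completion u(1) by (rule affine_state_mult)
  moreover have "(shift_op n b *\<^sub>v ?u) $ i = bit_sign (residue_xor n (rev (w @ [b])) i)"
    if "i < n" for i
  proof (cases "i = 0")
    case True
    have "(shift_op n b *\<^sub>v ?u) $ i
        = (\<Sum>j<Suc n. if j = n - 1 then bit_sign b * ?u $ j else 0)"
      unfolding shift_op_def affine_completion_mult_vec[OF carrier that]
      using True by (intro sum.cong) auto
    also have "\<dots> = bit_sign b * ?u $ (n - 1)"
      by (subst sum.delta) auto
    finally show ?thesis using u(2)[of "n - 1"] assms(1) True by (simp add: bit_sign_def)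
  next
    case False
    have "(shift_op n b *\<^sub>v ?u) $ i = (\<Sum>j<Suc n. if j = i - 1 then ?u $ j else 0)"
      unfolding shift_op_def affine_completion_mult_vec[OF carrier that]
      using False by (intro sum.cong) auto
    also have "\<dots> = ?u $ (i - 1)"
      using that by (subst sum.delta) auto
    finally show ?thesis using u(2)[of "i - 1"] that False by simp
  qed
  ultimately show ?case by (simp add: modxor_afa_def)
qed

text \<open>Coordinate 0 holds \<open>a\<close> and coordinate \<open>n\<close> the rest
  \<open>1 - a\<close>. Both are nonnegative since \<open>a\<close> is 0 or 1, so the norm equals
  the total.\<close>

lemma modxor_afa_final_state:
  fixes n :: nat and w :: "bool list"
  assumes "n > 0"
  defines "f \<equiv> final_state (modxor_afa n) w"
    and "a \<equiv> (if residue_xor n (rev w) (n - 1) then 1 else 0)"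
  shows "f $ 0 = a" and "(\<Sum>i<Suc n. \<bar>f $ i\<bar>) = 1"
proof -
  define v where "v = foldl (\<lambda>v a. symbol_op (modxor_afa n) a *\<^sub>v v) (init_state (modxor_afa n)) w"
  have v: "affine_state (Suc n) v" "v $ (n - 1) = bit_sign (residue_xor n (rev w) (n - 1))"
    using modxor_afa_run[OF assms(1), of w] assms(1) by (auto simp: v_def)
  then have carrier: "v \<in> carrier_vec (Suc n)" and total: "(\<Sum>j<Suc n. v $ j) = 1"
    by (auto simp: affine_state_def)
  have f: "f = readout_op n *\<^sub>v v"
    by (simp add: f_def final_state_def v_def modxor_afa_def)
  have "affine_state (Suc n) f"
    unfolding f readout_op_def using affine_operator_completion v(1) by (rule affine_state_mult)
  then have f_total: "(\<Sum>j<Suc n. f $ j) = 1" by (simp add: affine_state_def)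
  \<comment> \<open>Written as a difference so that the full sum of \<open>v\<close>, known to be 1,
    appears.\<close>
  have "f $ 0 = (\<Sum>j<Suc n. v $ j / 2 - (if j = n - 1 then v $ j / 2 else 0))"
    unfolding f readout_op_def affine_completion_mult_vec[OF carrier assms(1)]
    by (intro sum.cong) auto
  also have "\<dots> = (\<Sum>j<Suc n. v $ j) / 2 - v $ (n - 1) / 2"
    unfolding sum_subtractf sum_divide_distrib by (subst sum.delta) auto
  also have "\<dots> = a"
    unfolding total v(2) by (simp add: a_def bit_sign_def)
  finally show f0: "f $ 0 = a" .
  have zero: "f $ i = 0" if "0 < i" "i < n" for i
    unfolding f readout_op_def affine_completion_mult_vec[OF carrier that(2)]
    using that by simp
  \<comment> \<open>Used twice: the identity yields the last entry from the total, and
    \<open>abs\<close> yields the norm.\<close>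
  have "(\<Sum>i<n. g (f $ i)) = g (f $ 0)" if "g 0 = 0" for g :: "real \<Rightarrow> real"
  proof -
    have "(\<Sum>i<n. g (f $ i)) = (\<Sum>i<n. if i = 0 then g (f $ i) else 0)"
      using zero that by (intro sum.cong) auto
    also have "\<dots> = g (f $ 0)"
      using assms(1) by (subst sum.delta) auto
    finally show ?thesis .
  qed
  from this[of "\<lambda>x. x"] this[of abs]
  show "(\<Sum>i<Suc n. \<bar>f $ i\<bar>) = 1"
    using f_total f0 by (auto simp: a_def)
qed

theorem theorem12:
  fixes k :: nat
  assumes "k > 0"
  shows "\<exists>M :: bool afa. is_afa M \<and> num_states M = 2 * k + 1 \<and> recognizes_zero_error M (MODXOR k)"
proof (intro exI conjI)
  let ?M = "modxor_afa (2 * k)"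
  have fields: "num_states ?M = Suc (2 * k)" "accepting ?M = {0}"
    by (simp_all add: modxor_afa_def)
  \<comment> \<open>The numerator is the 0/1 entry at coordinate 0, the denominator is 1.\<close>
  have "accept_prob ?M w = (if w \<in> MODXOR k then 1 else 0)" for w
    using modxor_afa_final_state[of "2 * k" w] assms
    unfolding accept_prob_def fields MODXOR_iff_residue_xor[OF assms]
    by (simp del: sum.lessThan_Suc)
  then show "recognizes_zero_error ?M (MODXOR k)"
    by (simp add: recognizes_zero_error_def)
  show "num_states ?M = 2 * k + 1" by (simp add: fields)
  show "is_afa ?M" by (rule is_afa_modxor)
qed

end
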